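(* Let $\mathcal{A}$ be a $C^*$-algebra with unit $1$ and let $n\ge2$. Then: (1) $\mathbf{PI}_n(\mathcal{A})$ is open in $\mathbf{P}_n(\mathcal{A})$. (2) $\mathbf{PC}_n(\mathcal{A})$ is a clopen subset of $\mathbf{PI}_n(\mathcal{A})$. (3) $\mathbf{PO}_n(\mathcal{A})$ is a strong deformation retract of $\mathbf{PC}_n(\mathcal{A})$. (4) $\mathbf{PC}_n(\mathcal{A})$ is locally connected, and every connected component of $\mathbf{PC}_n(\mathcal{A})$ is path-connected. (5) Two elements $(P_1,\dots,P_n),(P_1',\dots,P_n')\in\mathbf{PC}_n(\mathcal{A})$ are in the same connected component of $\mathbf{PC}_n(\mathcal{A})$ if and only if there is $D\in GL_0(\mathcal{A})$ such that $P_i=D^*P_i'D$, $i=1,\dots,n$.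
   Context: A projection in $\mathcal{A}$ is an element $P$ with $P=P^*=P^2$; it is non-trivial if $P\ne0$ and $P\ne1$. $GL(\mathcal{A})$ is the group of invertible elements of $\mathcal{A}$ and $GL_0(\mathcal{A})$ is the connected component of $1$ in $GL(\mathcal{A})$. $\mathbf{P}_n(\mathcal{A})$ is the set of $n$-tuples of non-trivial projections in $\mathcal{A}$, with the norm topology as a subset of $\mathcal{A}^n$; its subsets carry the subspace topology. Define - $\mathbf{PI}_n(\mathcal{A})=\{(P_1,\dots,P_n)\in\mathbf{P}_n(\mathcal{A}) : \sum_{i=1}^nP_i\in GL(\mathcal{A})\}$; - $\mathbf{PC}_n(\mathcal{A})$: the set of $(P_1,\dots,P_n)\in\mathbf{P}_n(\mathcal{A})$ such that $\mathcal{A}$ is the linear (algebraic) direct sum of the subspaces $P_i\mathcal{A}=\{P_ix:x\in\mathcal{A}\}$, $i=1,\dots,n$ (one has $\mathbf{PC}_n(\mathcal{A})\subset\mathbf{PI}_n(\mathcal{A})$); - $\mathbf{PO}_n(\mathcal{A})=\{(P_1,\dots,P_n)\in\mathbf{P}_n(\mathcal{A}) : \sum_{i=1}^nP_i=1,\ P_iP_j=0 \text{ for } i\ne j\}$. *)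

theory Defs
  imports "HOL-Analysis.Analysis"
begin

(* The real scaling, the norm, completeness and the unit come from the superclasses
   (which also give 0 ~= 1); the complex scaling extends the real one. *)
class cstar_algebra = real_normed_algebra_1 + banach +
  fixes scaleC :: "complex \<Rightarrow> 'a \<Rightarrow> 'a" (infixr \<open>*\<^sub>C\<close> 75)
    and star :: "'a \<Rightarrow> 'a"
  assumes scaleC_add_right: "c *\<^sub>C (x + y) = c *\<^sub>C x + c *\<^sub>C y"
    and scaleC_add_left: "(c + d) *\<^sub>C x = c *\<^sub>C x + d *\<^sub>C x"
    and scaleC_scaleC: "c *\<^sub>C (d *\<^sub>C x) = (c * d) *\<^sub>C x"
    and scaleR_scaleC: "r *\<^sub>R x = complex_of_real r *\<^sub>C x"
    and mult_scaleC_left: "(c *\<^sub>C x) * y = c *\<^sub>C (x * y)"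
    and mult_scaleC_right: "x * (c *\<^sub>C y) = c *\<^sub>C (x * y)"
    and norm_scaleC: "norm (c *\<^sub>C x) = cmod c * norm x"
    and star_star: "star (star x) = x"
    and star_add: "star (x + y) = star x + star y"
    and star_scaleC: "star (c *\<^sub>C x) = cnj c *\<^sub>C star x"
    and star_mult: "star (x * y) = star y * star x"
    and norm_star_mult_self: "norm (star x * x) = (norm x)\<^sup>2"

instantiation complex :: cstar_algebra
begin

definition scaleC_complex :: "complex \<Rightarrow> complex \<Rightarrow> complex"
  where "scaleC_complex c z = c * z"

definition star_complex :: "complex \<Rightarrow> complex"
  where "star_complex z = cnj z"

instance
  by standard
    (auto simp: scaleC_complex_def star_complex_def algebra_simps scaleR_conv_of_real
      norm_mult power2_eq_square)

end

definition GL :: "'a::cstar_algebra set"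
  where "GL = {a. \<exists>b. a * b = 1 \<and> b * a = 1}"

definition GL0 :: "'a::cstar_algebra set"
  where "GL0 = connected_component_set GL 1"

definition projection :: "'a::cstar_algebra \<Rightarrow> bool"
  where "projection P \<longleftrightarrow> star P = P \<and> P * P = P"

definition nontrivial_projection :: "'a::cstar_algebra \<Rightarrow> bool"
  where "nontrivial_projection P \<longleftrightarrow> projection P \<and> P \<noteq> 0 \<and> P \<noteq> 1"

definition direct_sum_decomposition :: "('n::finite \<Rightarrow> 'a::comm_monoid_add set) \<Rightarrow> bool"
  where "direct_sum_decomposition V \<longleftrightarrow>
    (\<forall>x. \<exists>!y. (\<forall>i. y i \<in> V i) \<and> x = (\<Sum>i\<in>UNIV. y i))"

(* An n-tuple is a vector indexed by a finite type 'n with n = CARD('n); the topology of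
   'a ^ 'n is the product topology, i.e. the norm topology of the n-fold power. *)
definition PP :: "('a::cstar_algebra ^ 'n) set"
  where "PP = {P. \<forall>i. nontrivial_projection (P $ i)}"

definition PI :: "('a::cstar_algebra ^ 'n) set"
  where "PI = {P \<in> PP. (\<Sum>i\<in>UNIV. P $ i) \<in> GL}"

definition PC :: "('a::cstar_algebra ^ 'n) set"
  where "PC = {P \<in> PP. direct_sum_decomposition (\<lambda>i. range (\<lambda>x. P $ i * x))}"

definition PO :: "('a::cstar_algebra ^ 'n) set"
  where "PO = {P \<in> PP. (\<Sum>i\<in>UNIV. P $ i) = 1 \<and> (\<forall>i j. i \<noteq> j \<longrightarrow> P $ i * P $ j = 0)}"

(* The homotopy stays inside S, starts at the identity, ends at a retraction onto T and fixes
   every point of T at all times. *)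
definition strong_deformation_retract_of :: "'b::topological_space set \<Rightarrow> 'b set \<Rightarrow> bool"
    (infixl \<open>strong'_deformation'_retract'_of\<close> 50)
  where "T strong_deformation_retract_of S \<longleftrightarrow>
    (\<exists>r. retraction S T r \<and> homotopic_with_canon (\<lambda>h. \<forall>x\<in>T. h x = x) S S id r)"

end

theory Submission
  imports Defs
begin

text \<open>A tuple \<open>P\<close> is complete iff its sum \<open>A\<close> is invertible and the elements
  \<open>E\<^sub>i = P\<^sub>i A\<^sup>-\<^sup>1\<close> are mutually orthogonal idempotents with sum 1; then
  \<open>E\<^sub>i\<close> and \<open>P\<^sub>i\<close> generate the same right ideal, so \<open>P\<^sub>i\<close> is the range projection of
  \<open>E\<^sub>i\<close>. Hence the invertible group acts continuously on complete tuples, \<open>D\<close> sending \<open>P\<close>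
  to the range projections of \<open>D E\<^sub>i D\<^sup>-\<^sup>1\<close>. For \<open>Q\<close> near \<open>P\<close> the element
  \<open>W = \<Sum>\<^sub>i Q\<^sub>i E\<^sub>i\<close> is near 1 and moves \<open>P\<close> to \<open>Q\<close>, so the orbit maps have local
  sections; this gives openness and local path-connectedness. With \<open>R = (A/n)\<^sup>1\<^sup>/\<^sup>2\<close>, the
  action of \<open>((1 - t) + t R)\<^sup>-\<^sup>1\<close> deforms \<open>P\<close> to the orthogonal tuple
  \<open>n\<^sup>-\<^sup>1 R\<^sup>-\<^sup>1 P\<^sub>i R\<^sup>-\<^sup>1\<close>, which is also congruent to \<open>P\<close>, and nearby orthogonal tuples
  are unitarily equivalent. Positivity is never needed: \<open>1 - A/n\<close> has norm at most 1,
  and the binomial series of the square root converges absolutely there.\<close>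

subsection \<open>Invertible elements\<close>

text \<open>Neumann series: the powers of \<open>x\<close> sum absolutely, and multiplying the
  series by \<open>x\<close> on either side just drops its head.\<close>

lemma one_minus_inverse_exists:
  fixes x :: "'a::{real_normed_algebra_1,banach}"
  assumes "norm x < 1"
  shows "\<exists>b. (1 - x) * b = 1 \<and> b * (1 - x) = 1"
proof -
  have s: "summable (\<lambda>n. x ^ n)"
    by (rule summable_comparison_test'[where g = "\<lambda>n. norm x ^ n" and N = 0])
       (use assms in \<open>auto intro: summable_geometric norm_power_ineq\<close>)
  have tail: "(\<Sum>n. x ^ Suc n) = (\<Sum>n. x ^ n) - 1"
    using suminf_split_head[OF s] by simp
  have "x * (\<Sum>n. x ^ n) = (\<Sum>n. x ^ n) - 1"
    using suminf_mult[OF s, of x] tail by simp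
  moreover have "(\<Sum>n. x ^ n) * x = (\<Sum>n. x ^ n) - 1"
    using suminf_mult2[OF s, of x] tail by (simp add: power_commutes)
  ultimately show ?thesis
    by (intro exI[of _ "\<Sum>n. x ^ n"]) (simp add: algebra_simps)
qed

lemma GL_if_near_one:
  fixes a :: "'a::cstar_algebra"
  assumes "norm (1 - a) < 1"
  shows "a \<in> GL"
  using one_minus_inverse_exists[OF assms] by (simp add: GL_def)

definition ginv :: "'a::cstar_algebra \<Rightarrow> 'a"
  where "ginv a = (SOME b. a * b = 1 \<and> b * a = 1)"

lemma ginv:
  assumes "a \<in> GL"
  shows ginv_right: "a * ginv a = 1" and ginv_left: "ginv a * a = 1"
  using someI_ex[of "\<lambda>b. a * b = 1 \<and> b * a = 1"] assms by (auto simp: GL_def ginv_def)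

lemma ginv_cancel:
  assumes "a \<in> GL"
  shows "a * (ginv a * x) = x" "ginv a * (a * x) = x"
  by (simp_all add: mult.assoc[symmetric] ginv[OF assms])

lemma ginv_unique:
  fixes a :: "'a::cstar_algebra"
  assumes "a * b = 1" "b * a = 1"
  shows "a \<in> GL" "ginv a = b"
proof -
  show a: "a \<in> GL"
    using assms by (auto simp: GL_def)
  have "b * (a * ginv a) = (b * a) * ginv a"
    by (simp only: mult.assoc)
  then show "ginv a = b"
    using assms ginv_right[OF a] by simp
qed

lemma GL_one: "1 \<in> GL" and ginv_one: "ginv 1 = 1"
  by (simp_all add: ginv_unique[of 1 1])

lemma GL_mult:
  assumes "a \<in> GL" "b \<in> GL"
  shows "a * b \<in> GL" "ginv (a * b) = ginv b * ginv a"
  using ginv_unique[of "a * b" "ginv b * ginv a"]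
  by (simp_all add: mult.assoc ginv[OF assms(1)] ginv[OF assms(2)] ginv_cancel[OF assms(1)]
      ginv_cancel[OF assms(2)])

lemma GL_ginv:
  assumes "a \<in> GL"
  shows "ginv a \<in> GL" "ginv (ginv a) = a"
  using ginv_unique[of "ginv a" a] ginv[OF assms] by simp_all

lemma GL_if_left_right_inverse:
  fixes a :: "'a::cstar_algebra"
  assumes "a * b = 1" "c * a = 1"
  shows "a \<in> GL"
proof -
  have "c = c * (a * b)"
    using assms by simp
  also have "\<dots> = (c * a) * b"
    by (simp only: mult.assoc)
  finally have "c = b"
    using assms by simp
  then show ?thesis
    using assms by (intro ginv_unique(1)[of a b]) simp_all
qed

text \<open>Inverting the square yields a right and a left inverse. This serves the binomial square
  root and the element inverted in Kaplansky's formula.\<close>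

lemma GL_if_square:
  assumes "a * a \<in> GL"
  shows "a \<in> GL"
  by (rule GL_if_left_right_inverse[of _ "a * ginv (a * a)" "ginv (a * a) * a"])
     (use ginv[OF assms] in \<open>simp_all add: mult.assoc\<close>)

lemma GL_scaleR:
  fixes a :: "'a::cstar_algebra"
  assumes "a \<in> GL" "r \<noteq> 0"
  shows "r *\<^sub>R a \<in> GL" "ginv (r *\<^sub>R a) = inverse r *\<^sub>R ginv a"
  using ginv_unique[of "r *\<^sub>R a" "inverse r *\<^sub>R ginv a"] assms by (simp_all add: ginv)

lemma ginv_commute:
  assumes "a \<in> GL" "a * x = x * a"
  shows "ginv a * x = x * ginv a"
proof -
  have "ginv a * x = ginv a * (x * a) * ginv a"
    by (simp add: mult.assoc ginv_right[OF assms(1)])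
  also have "\<dots> = x * ginv a"
    by (simp add: assms(2)[symmetric] ginv_cancel[OF assms(1)])
  finally show ?thesis .
qed

text \<open>In \<open>x = a * (ginv a * x)\<close> the second factor is at distance less than 1 from
  \<open>1\<close> on the ball of radius \<open>1 / norm (ginv a)\<close>.\<close>

lemma open_GL: "open (GL :: 'a::cstar_algebra set)"
proof (rule openI)
  fix a :: 'a assume a: "a \<in> GL"
  have n0: "norm (ginv a) > 0"
    using ginv_right[OF a] by force
  have "x \<in> GL" if "x \<in> ball a (1 / norm (ginv a))" for x
  proof -
    have "1 - ginv a * x = ginv a * (a - x)"
      using a by (simp add: right_diff_distrib ginv)
    then have "norm (1 - ginv a * x) \<le> norm (ginv a) * norm (a - x)"
      by (simp add: norm_mult_ineq)
    also have "\<dots> < 1"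
      using that n0 by (simp add: dist_norm field_simps)
    finally have "ginv a * x \<in> GL"
      by (rule GL_if_near_one)
    then have "a * (ginv a * x) \<in> GL"
      by (rule GL_mult(1)[OF a])
    then show ?thesis
      by (simp add: ginv_cancel[OF a])
  qed
  then show "\<exists>T>0. ball a T \<subseteq> GL"
    using n0 by (intro exI[of _ "1 / norm (ginv a)"]) auto
qed

lemma continuous_on_ginv_GL: "continuous_on GL (ginv :: 'a::cstar_algebra \<Rightarrow> 'a)"
proof (rule continuous_on_def[THEN iffD2], rule ballI)
  fix a :: 'a assume a: "a \<in> GL"
  define b where "b = ginv a"
  have n0: "norm b > 0"
    using ginv_right[OF a] b_def by force
  have bound: "norm (ginv x - b) \<le> 2 * norm b * norm b * norm (x - a)"
    if x: "x \<in> GL" "norm (x - a) < 1 / (2 * norm b)" for x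
  proof -
    have eq: "ginv x - b = ginv x * (a - x) * b"
      using a x(1) by (simp add: algebra_simps b_def ginv ginv_cancel mult.assoc)
    have nle: "norm (ginv x - b) \<le> norm (ginv x) * norm (x - a) * norm b"
      proof -
      have "norm (ginv x - b) \<le> norm (ginv x * (a - x)) * norm b"
        unfolding eq by (rule norm_mult_ineq)
      also have "\<dots> \<le> (norm (ginv x) * norm (a - x)) * norm b"
        by (intro mult_right_mono norm_mult_ineq norm_ge_zero)
      finally show ?thesis
        by (simp add: norm_minus_commute)
    qed
    \<comment> \<open>The radius \<open>1 / (2 * norm b)\<close> makes the error at most half of
      \<open>norm (ginv x)\<close>, so it is absorbed into the left side.\<close>
    have "norm (ginv x) \<le> norm b + norm (ginv x - b)"
      by (metis add.commute diff_add_cancel norm_triangle_ineq)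
    also have "\<dots> \<le> norm b + norm (ginv x) * (norm (x - a) * norm b)"
      using nle by (simp add: mult.assoc)
    also have "norm (x - a) * norm b \<le> 1 / 2"
      using x(2) n0 by (simp add: field_simps)
    finally have "norm (ginv x) \<le> 2 * norm b"
      by (simp add: mult_left_mono)
    then have "norm (ginv x) * (norm (x - a) * norm b) \<le> 2 * norm b * (norm (x - a) * norm b)"
      by (rule mult_right_mono) simp
    then show ?thesis
      using nle by (simp add: mult_ac)
  qed
  have "\<forall>\<^sub>F x in at a within GL. norm (ginv x - b) \<le> 2 * norm b * norm b * norm (x - a)"
    unfolding eventually_at
  proof (intro exI[of _ "1 / (2 * norm b)"] conjI ballI impI)
    show "0 < 1 / (2 * norm b)"
      using n0 by simp
  qed (rule bound, simp_all add: dist_norm)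
  moreover have "((\<lambda>x. 2 * norm b * norm b * norm (x - a)) \<longlongrightarrow> 2 * norm b * norm b * norm (a - a))
      (at a within GL)"
    by (intro tendsto_intros)
  then have "((\<lambda>x. 2 * norm b * norm b * norm (x - a)) \<longlongrightarrow> 0) (at a within GL)"
    by simp
  ultimately have "((\<lambda>x. ginv x - b) \<longlongrightarrow> 0) (at a within GL)"
    by (rule Lim_null_comparison)
  then show "(ginv \<longlongrightarrow> ginv a) (at a within GL)"
    unfolding b_def by (rule LIM_zero_cancel)
qed

lemma continuous_on_ginv:
  fixes f :: "'b::topological_space \<Rightarrow> 'a::cstar_algebra"
  assumes "continuous_on S f" "\<And>x. x \<in> S \<Longrightarrow> f x \<in> GL"
  shows "continuous_on S (\<lambda>x. ginv (f x))"
  using assms by (intro continuous_on_compose2[OF continuous_on_ginv_GL]) auto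

subsection \<open>The involution\<close>

text \<open>The C*-identity gives \<open>norm y * norm y \<le> norm (star y) * norm y\<close>;
  cancel, and use this for both \<open>x\<close> and \<open>star x\<close>.\<close>

lemma norm_star:
  fixes x :: "'a::cstar_algebra"
  shows "norm (star x) = norm x"
proof -
  have le: "norm y \<le> norm (star y)" for y :: 'a
  proof (cases "y = 0")
    case False
    have "norm y * norm y \<le> norm (star y) * norm y"
      using norm_mult_ineq[of "star y" y] by (simp add: norm_star_mult_self power2_eq_square)
    then show ?thesis
      using False by simp
  qed simp
  show ?thesis
    using le[of x] le[of "star x"] by (simp add: star_star)
qed

lemma bounded_linear_star: "bounded_linear (star :: 'a::cstar_algebra \<Rightarrow> 'a)"
  by (rule bounded_linear_intro[where K = 1])
     (simp_all add: star_add scaleR_scaleC star_scaleC norm_star)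

lemmas continuous_on_star = bounded_linear.continuous_on[OF bounded_linear_star]

lemma star_simps:
  shows star_zero: "star (0 :: 'a::cstar_algebra) = 0"
    and star_one: "star (1 :: 'a) = 1"
    and star_diff: "star (x - y :: 'a) = star x - star y"
    and star_scaleR: "star (r *\<^sub>R x) = r *\<^sub>R star x"
    and star_sum: "star (sum f I) = (\<Sum>i\<in>I. star (f i :: 'a))"
proof -
  interpret bounded_linear "star :: 'a \<Rightarrow> 'a"
    by (rule bounded_linear_star)
  show "star (0 :: 'a) = 0" "star (x - y) = star x - star y"
       "star (r *\<^sub>R x) = r *\<^sub>R star x" "star (sum f I) = (\<Sum>i\<in>I. star (f i))"
    by (rule zero diff scaleR sum)+
  show "star (1 :: 'a) = 1"
    using star_mult[of "star (1 :: 'a)" 1] by (simp add: star_star)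
qed

lemma GL_star:
  assumes "a \<in> GL"
  shows "star a \<in> GL" "ginv (star a) = star (ginv a)"
  using ginv_unique[of "star a" "star (ginv a)"]
  by (simp_all add: star_mult[symmetric] ginv[OF assms] star_one)

subsection \<open>The binomial series of the square root\<close>

text \<open>The Taylor coefficients of sqrt(1 - x) at 0.\<close>

definition sqrt_coeff :: "nat \<Rightarrow> real"
  where "sqrt_coeff k = (-1) ^ k * ((1 / 2) gchoose k)"

lemma sqrt_coeff_0: "sqrt_coeff 0 = 1"
  by (simp add: sqrt_coeff_def)

lemma sqrt_coeff_Suc_le_0: "sqrt_coeff (Suc k) \<le> 0"
proof -
  have "sqrt_coeff (Suc k) = pochhammer (-1 / 2) (Suc k) / fact (Suc k)"
    by (simp add: sqrt_coeff_def gbinomial_pochhammer)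
  also have "\<dots> = (-1 / 2) * (pochhammer (1 / 2) k / fact (Suc k))"
    by (simp add: pochhammer_rec)
  also have "\<dots> \<le> 0"
    by (simp add: pochhammer_nonneg)
  finally show ?thesis .
qed

text \<open>Dividing sqrt(1 - x) by 1 - x shows that the partial sums are the coefficients of (1 -
  x)^(-1/2), which are non-negative.\<close>

lemma sum_sqrt_coeff_ge_0: "0 \<le> (\<Sum>k\<le>m. sqrt_coeff k)"
proof -
  have "(\<Sum>k\<le>m. sqrt_coeff k) = (-1) ^ m * ((1 / 2 - 1) gchoose m)"
    using gbinomial_sum_lower_neg[of "1 / 2 :: real" m] by (simp add: sqrt_coeff_def mult.commute)
  also have "\<dots> = pochhammer (1 / 2) m / fact m"
    by (simp add: gbinomial_pochhammer)
  also have "\<dots> \<ge> 0"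
    by (simp add: pochhammer_nonneg)
  finally show ?thesis .
qed

text \<open>All coefficients after the first have the same sign, so the absolute sum is 1 minus a
  non-negative partial sum.\<close>

lemma sum_abs_sqrt_coeff_Suc_le: "(\<Sum>k<m. \<bar>sqrt_coeff (Suc k)\<bar>) \<le> 1"
proof -
  have "(\<Sum>k<m. \<bar>sqrt_coeff (Suc k)\<bar>) = - (\<Sum>k<m. sqrt_coeff (Suc k))"
    by (simp add: sqrt_coeff_Suc_le_0 abs_of_nonpos sum_negf)
  also have "(\<Sum>k<m. sqrt_coeff (Suc k)) = (\<Sum>k\<le>m. sqrt_coeff k) - 1"
    by (simp add: sum.atMost_shift sqrt_coeff_0)
  finally show ?thesis
    using sum_sqrt_coeff_ge_0[of m] by simp
qed

lemma summable_abs_sqrt_coeff_Suc: "summable (\<lambda>k. \<bar>sqrt_coeff (Suc k)\<bar>)"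
  by (rule bounded_imp_summable[where B = 1])
     (use sum_abs_sqrt_coeff_Suc_le[of "Suc _"] in \<open>simp_all add: lessThan_Suc_atMost\<close>)

lemma summable_abs_sqrt_coeff: "summable (\<lambda>k. \<bar>sqrt_coeff k\<bar>)"
  using summable_abs_sqrt_coeff_Suc by (simp add: summable_Suc_iff[of "\<lambda>k. \<bar>sqrt_coeff k\<bar>"])

text \<open>Vandermonde's identity with 1/2 + 1/2 = 1: squaring sqrt(1 - x) leaves the coefficients
  of 1 - x.\<close>

lemma sqrt_coeff_convolution:
  "(\<Sum>i\<le>k. sqrt_coeff i * sqrt_coeff (k - i)) = (if k = 0 then 1 else if k = 1 then -1 else 0)"
proof -
  have "(\<Sum>i\<le>k. sqrt_coeff i * sqrt_coeff (k - i))
      = (-1) ^ k * (\<Sum>i\<le>k. ((1 / 2) gchoose i) * ((1 / 2 :: real) gchoose (k - i)))"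
    unfolding sum_distrib_left
    by (rule sum.cong) (simp_all add: sqrt_coeff_def power_add[symmetric])
  also have "\<dots> = (-1) ^ k * ((1 / 2 + 1 / 2) gchoose k)"
    by (simp only: gbinomial_Vandermonde atMost_atLeast0)
  also have "\<dots> = (-1) ^ k * real (1 choose k)"
    using binomial_gbinomial[of 1 k, where 'a = real] by simp
  also have "\<dots> = (if k = 0 then 1 else if k = 1 then -1 else 0)"
    by (cases k) (auto simp: binomial_eq_0)
  finally show ?thesis .
qed

text \<open>The series converges absolutely also on the boundary of the unit ball, so no functional
  calculus is needed for the square root of a positive invertible element.\<close>

definition binomial_sqrt :: "'a::cstar_algebra \<Rightarrow> 'a"
  where "binomial_sqrt h = (\<Sum>k. sqrt_coeff k *\<^sub>R (1 - h) ^ k)"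

context
  fixes h :: "'a::cstar_algebra"
  assumes h: "norm (1 - h) \<le> 1"
begin

lemma norm_sqrt_term_le: "norm (sqrt_coeff k *\<^sub>R (1 - h) ^ k) \<le> \<bar>sqrt_coeff k\<bar>"
proof -
  have "norm ((1 - h) ^ k) \<le> 1"
    using norm_power_ineq[of "1 - h" k] h by (meson norm_ge_zero order_trans power_le_one)
  then show ?thesis
    by (simp add: mult_left_le)
qed

lemma summable_norm_sqrt_terms: "summable (\<lambda>k. norm (sqrt_coeff k *\<^sub>R (1 - h) ^ k))"
  by (rule summable_comparison_test'[OF summable_abs_sqrt_coeff])
     (use norm_sqrt_term_le in auto)

lemma summable_sqrt_terms: "summable (\<lambda>k. sqrt_coeff k *\<^sub>R (1 - h) ^ k)"
  by (rule summable_norm_cancel[OF summable_norm_sqrt_terms])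

lemma binomial_sqrt_square: "binomial_sqrt h * binomial_sqrt h = h"
proof -
  have "binomial_sqrt h * binomial_sqrt h =
      (\<Sum>k. \<Sum>i\<le>k. (sqrt_coeff i *\<^sub>R (1 - h) ^ i) * (sqrt_coeff (k - i) *\<^sub>R (1 - h) ^ (k - i)))"
    unfolding binomial_sqrt_def by (rule Cauchy_product) (rule summable_norm_sqrt_terms)+
  also have "\<dots> = (\<Sum>k. (\<Sum>i\<le>k. sqrt_coeff i * sqrt_coeff (k - i)) *\<^sub>R (1 - h) ^ k)"
    unfolding scaleR_sum_left
    by (intro suminf_cong sum.cong) (simp_all add: power_add[symmetric] mult.commute)
  also have "\<dots> = (\<Sum>k\<in>{0, 1}. (\<Sum>i\<le>k. sqrt_coeff i * sqrt_coeff (k - i)) *\<^sub>R (1 - h) ^ k)"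
    by (rule suminf_finite) (simp_all add: sqrt_coeff_convolution)
  also have "\<dots> = h"
    by (simp add: sqrt_coeff_convolution del: One_nat_def)
  finally show ?thesis .
qed

lemma binomial_sqrt_commute:
  assumes "h * x = x * h"
  shows "binomial_sqrt h * x = x * binomial_sqrt h"
proof -
  have "(1 - h) ^ k * x = x * (1 - h) ^ k" for k
    by (rule power_commuting_commutes) (simp add: assms algebra_simps)
  then show ?thesis
    unfolding binomial_sqrt_def
    by (simp add: suminf_mult[OF summable_sqrt_terms, symmetric]
        suminf_mult2[OF summable_sqrt_terms])
qed

lemma star_binomial_sqrt:
  assumes "star h = h"
  shows "star (binomial_sqrt h) = binomial_sqrt h"
proof -
  have "star ((1 - h) ^ k) = (1 - h) ^ k" for k
    by (induction k) (simp_all add: star_simps star_mult assms power_commutes)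
  then show ?thesis
    unfolding binomial_sqrt_def
    by (simp add: bounded_linear.suminf[OF bounded_linear_star summable_sqrt_terms] star_scaleR)
qed

text \<open>The head of the series is \<open>1\<close>, and the other coefficients have absolute sum
  at most 1. For an invertible root this keeps the segment from \<open>1\<close> to it inside
  \<open>GL\<close>.\<close>

lemma norm_one_minus_binomial_sqrt: "norm (1 - binomial_sqrt h) \<le> 1"
proof -
  have sm: "summable (\<lambda>k. norm (sqrt_coeff (Suc k) *\<^sub>R (1 - h) ^ Suc k))"
    using summable_norm_sqrt_terms
    by (subst summable_Suc_iff[of "\<lambda>k. norm (sqrt_coeff k *\<^sub>R (1 - h) ^ k)"])
  have "1 - binomial_sqrt h = - (\<Sum>k. sqrt_coeff (Suc k) *\<^sub>R (1 - h) ^ Suc k)"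
    using suminf_split_head[OF summable_sqrt_terms] by (simp add: binomial_sqrt_def sqrt_coeff_0)
  then have "norm (1 - binomial_sqrt h) \<le> (\<Sum>k. norm (sqrt_coeff (Suc k) *\<^sub>R (1 - h) ^ Suc k))"
    using summable_norm[OF sm] by simp
  also have "\<dots> \<le> (\<Sum>k. \<bar>sqrt_coeff (Suc k)\<bar>)"
    by (rule suminf_le[OF norm_sqrt_term_le sm summable_abs_sqrt_coeff_Suc])
  also have "\<dots> \<le> 1"
    by (rule suminf_le_const[OF summable_abs_sqrt_coeff_Suc sum_abs_sqrt_coeff_Suc_le])
  finally show ?thesis .
qed

lemma binomial_sqrt_GL: "h \<in> GL \<Longrightarrow> binomial_sqrt h \<in> GL"
  by (rule GL_if_square) (simp add: binomial_sqrt_square)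

end

lemma continuous_on_binomial_sqrt:
  "continuous_on {h. norm (1 - h) \<le> 1} (binomial_sqrt :: 'a::cstar_algebra \<Rightarrow> 'a)"
proof -
  have "uniform_limit {h. norm (1 - h) \<le> 1} (\<lambda>n h :: 'a. \<Sum>k<n. sqrt_coeff k *\<^sub>R (1 - h) ^ k)
      binomial_sqrt sequentially"
    unfolding binomial_sqrt_def
    by (rule Weierstrass_m_test[OF _ summable_abs_sqrt_coeff])
       (use norm_sqrt_term_le in auto)
  moreover have "\<forall>\<^sub>F n in sequentially.
      continuous_on {h. norm (1 - h) \<le> 1} (\<lambda>h :: 'a. \<Sum>k<n. sqrt_coeff k *\<^sub>R (1 - h) ^ k)"
    by (intro always_eventually allI continuous_intros)
  ultimately show ?thesis
    by (intro uniform_limit_theorem) auto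
qed

text \<open>For \<open>t < 1\<close> the combination has distance at most \<open>t\<close> from
  \<open>1\<close>; for \<open>t = 1\<close> it is \<open>a\<close> itself.\<close>

lemma convex_combination_GL:
  fixes a :: "'a::cstar_algebra"
  assumes "a \<in> GL" "norm (1 - a) \<le> 1" "0 \<le> t" "t \<le> 1"
  shows "(1 - t) *\<^sub>R 1 + t *\<^sub>R a \<in> GL"
proof (cases "t = 1")
  case False
  have "1 - ((1 - t) *\<^sub>R 1 + t *\<^sub>R a) = t *\<^sub>R (1 - a)"
    by (simp add: algebra_simps)
  then have "norm (1 - ((1 - t) *\<^sub>R 1 + t *\<^sub>R a)) \<le> t"
    using assms by (simp add: mult_left_le)
  then show ?thesis
    using False assms by (intro GL_if_near_one) simp
qed (use assms in simp)

subsection \<open>The identity component\<close>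

lemma GL0_subset_GL: "GL0 \<subseteq> GL"
  by (simp add: GL0_def connected_component_subset)

lemma GL0_one: "1 \<in> GL0"
  by (simp add: GL0_def GL_one)

lemma connected_GL0: "connected GL0"
  by (simp add: GL0_def)

text \<open>The closure properties of \<open>GL0\<close> below all exhibit a connected subset of
  \<open>GL\<close> through a known point of \<open>GL0\<close>.\<close>

lemma GL0_if_connected:
  assumes "connected S" "S \<subseteq> GL" "a \<in> S" "b \<in> S" "a \<in> GL0"
  shows "b \<in> GL0"
  using assms connected_component_trans[of GL 1 a b] connected_componentI[of S GL a b]
  by (auto simp: GL0_def)

lemma GL0_mult:
  assumes "a \<in> GL0" "b \<in> GL0"
  shows "a * b \<in> GL0"
proof (rule GL0_if_connected[of "(\<lambda>x. a * x) ` GL0" a])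
  show "connected ((\<lambda>x. a * x) ` GL0)"
    by (intro connected_continuous_image connected_GL0 continuous_intros)
  show "(\<lambda>x. a * x) ` GL0 \<subseteq> GL"
    using assms GL0_subset_GL by (auto intro: GL_mult)
  show "a \<in> (\<lambda>x. a * x) ` GL0"
    using GL0_one by (force intro: image_eqI[of _ _ 1])
qed (use assms in auto)

lemma GL0_ginv:
  assumes "a \<in> GL0"
  shows "ginv a \<in> GL0"
proof (rule GL0_if_connected[of "ginv ` GL0" 1])
  show "connected (ginv ` (GL0 :: 'a set))"
    using GL0_subset_GL
    by (intro connected_continuous_image connected_GL0 continuous_on_ginv continuous_intros) auto
  show "1 \<in> ginv ` (GL0 :: 'a set)"
    using GL0_one ginv_one by (metis image_eqI)
qed (use assms GL0_subset_GL GL0_one in \<open>auto intro: GL_ginv\<close>)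

lemma GL0_star:
  assumes "a \<in> GL0"
  shows "star a \<in> GL0"
proof (rule GL0_if_connected[of "star ` GL0" 1])
  show "connected (star ` (GL0 :: 'a set))"
    by (intro connected_continuous_image connected_GL0 continuous_on_star continuous_intros)
  show "1 \<in> star ` (GL0 :: 'a set)"
    using GL0_one star_one by (metis image_eqI)
qed (use assms GL0_subset_GL GL0_one in \<open>auto intro: GL_star\<close>)

lemma GL0_if_near_one:
  assumes "a \<in> GL" "norm (1 - a) \<le> 1"
  shows "a \<in> GL0"
proof (rule GL0_if_connected[of "closed_segment 1 a" 1])
  show "closed_segment 1 a \<subseteq> GL"
    using convex_combination_GL[OF assms] by (auto simp: closed_segment_def)
qed (use GL0_one in auto)

lemma GL0_of_real_pos:
  assumes "r > 0"
  shows "r *\<^sub>R 1 \<in> (GL0 :: 'a::cstar_algebra set)"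
proof (rule GL0_if_connected[of "(\<lambda>s. s *\<^sub>R 1) ` {0<..}" "1 *\<^sub>R 1"])
  show "connected ((\<lambda>s. s *\<^sub>R 1 :: 'a) ` {0<..})"
    by (intro connected_continuous_image continuous_intros) auto
  show "(\<lambda>s. s *\<^sub>R 1 :: 'a) ` {0<..} \<subseteq> GL"
    by (auto intro: GL_scaleR GL_one)
  show "1 *\<^sub>R 1 \<in> (\<lambda>s. s *\<^sub>R 1 :: 'a) ` {0<..}"
    by (rule imageI) simp
qed (use assms GL0_one in auto)

subsection \<open>Range projections of idempotents\<close>

lemma norm_projection_le_1:
  assumes "projection p"
  shows "norm p \<le> 1"
proof (cases "p = 0")
  case False
  have "norm p * norm p = norm p"
    using norm_star_mult_self[of p] assms by (simp add: projection_def power2_eq_square)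
  then show ?thesis
    using False by simp
qed simp

lemma projection_one_minus: "projection p \<Longrightarrow> projection (1 - p)"
  by (simp add: projection_def star_simps algebra_simps)

text \<open>Spectrally, \<open>k\<close> is purely imaginary; here norms suffice. Scaled by
  \<open>1 / (s + 1)\<close>, the element differs from \<open>1\<close> by
  \<open>y / (s + 1)\<close>, and the C*-identity bounds the square of \<open>norm y\<close> by
  \<open>s * s + s\<close>, which is below the square of \<open>s + 1\<close>.\<close>

lemma one_plus_skew_GL:
  fixes k :: "'a::cstar_algebra"
  assumes "star k = - k"
  shows "1 + k \<in> GL"
proof -
  define s where "s = (norm k)\<^sup>2"
  define y where "y = s *\<^sub>R 1 - k"
  have s: "s \<ge> 0"
    by (simp add: s_def)
  have "star y * y = (s * s) *\<^sub>R 1 - k * k"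
    by (simp add: y_def star_diff star_scaleR star_one assms algebra_simps)
  then have "(norm y)\<^sup>2 = norm ((s * s) *\<^sub>R 1 - k * k)"
    by (metis norm_star_mult_self)
  also have "\<dots> \<le> norm ((s * s) *\<^sub>R (1 :: 'a)) + norm (k * k)"
    by (rule norm_triangle_ineq4)
  also have "\<dots> \<le> s * s + s"
    using norm_mult_ineq[of k k] by (simp add: power2_eq_square s_def)
  also have "\<dots> < (s + 1)\<^sup>2"
    using s by (simp add: power2_eq_square algebra_simps)
  finally have "norm y < s + 1"
    using s by (simp add: power_less_imp_less_base)
  moreover have "1 - inverse (s + 1) *\<^sub>R (1 + k) = inverse (s + 1) *\<^sub>R y"
  proof -
    have "1 - inverse (s + 1) *\<^sub>R (1 + k) = inverse (s + 1) *\<^sub>R ((s + 1) *\<^sub>R 1 - (1 + k))"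
      using s by (simp add: scaleR_diff_right)
    then show ?thesis
      by (simp add: y_def scaleR_add_left)
  qed
  ultimately have "norm (1 - inverse (s + 1) *\<^sub>R (1 + k)) < 1"
    using s by (simp only: norm_scaleR) (simp add: field_simps)
  then have "inverse (s + 1) *\<^sub>R (1 + k) \<in> GL"
    by (rule GL_if_near_one)
  then show ?thesis
    using s GL_scaleR(1)[of "inverse (s + 1) *\<^sub>R (1 + k)" "s + 1"] by simp
qed

text \<open>Kaplansky's formula.\<close>

definition range_projection :: "'a::cstar_algebra \<Rightarrow> 'a"
  where "range_projection e = e * ginv (e + star e - 1)"

context
  fixes e :: "'a::cstar_algebra"
  assumes idem: "e * e = e"
begin

private definition h where "h = e + star e - 1"

private lemma star_idem: "star e * star e = star e"
  by (simp add: idem flip: star_mult)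

text \<open>The square of this element is \<open>(1 - k) * (1 + k)\<close> for the skew element
  \<open>k = e - star e\<close>.\<close>

lemma idempotent_plus_star_GL: "e + star e - 1 \<in> GL"
proof (rule GL_if_square)
  define k where "k = e - star e"
  have "star k = - k"
    by (simp add: k_def star_simps star_star)
  moreover from this have "star (- k) = - (- k)"
    using star_diff[of 0 k] by (simp add: star_zero)
  ultimately have "1 + k \<in> GL" "1 + (- k) \<in> GL"
    by (blast intro: one_plus_skew_GL)+
  then have "(1 + (- k)) * (1 + k) \<in> GL"
    by (intro GL_mult)
  moreover have "(1 + (- k)) * (1 + k) = (e + star e - 1) * (e + star e - 1)"
    by (simp add: k_def algebra_simps idem star_idem)
  ultimately show "(e + star e - 1) * (e + star e - 1) \<in> GL"
    by simp
qed

private lemma h_GL: "h \<in> GL"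
  unfolding h_def by (rule idempotent_plus_star_GL)

text \<open>Read together: \<open>h\<close> intertwines \<open>e\<close> and \<open>star e\<close>
  in both directions.\<close>

private lemma mult_h: "e * h = e * star e" "h * star e = e * star e"
    "h * e = star e * e" "star e * h = star e * e"
  by (simp_all add: h_def algebra_simps idem star_idem)

private lemma star_ginv_h: "star (ginv h) = ginv h"
proof -
  have "star h = h"
    by (simp add: h_def star_simps star_add star_star add.commute)
  then show ?thesis
    using GL_star(2)[OF h_GL] by simp
qed

lemma projection_range_projection: "projection (range_projection e)"
  and range_projection_mult: "range_projection e * e = e"
  and mult_range_projection: "e * range_projection e = range_projection e"
proof -
  have rp: "range_projection e = e * ginv h"
    by (simp add: range_projection_def h_def)
  \<comment> \<open>The intertwining relation passes to \<open>ginv h\<close>; the result says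
    exactly that \<open>e * ginv h\<close> is self-adjoint.\<close>
  have "ginv h * star e = ginv h * (star e * h) * ginv h"
    by (simp add: mult.assoc ginv_right[OF h_GL])
  also have "star e * h = h * e"
    by (simp add: mult_h)
  also have "ginv h * (h * e) * ginv h = e * ginv h"
    by (simp add: ginv_cancel[OF h_GL])
  finally have c: "ginv h * star e = e * ginv h" .
  show 1: "e * range_projection e = range_projection e"
    by (simp add: rp idem flip: mult.assoc)
  have "range_projection e * e = e * (ginv h * e)"
    by (simp add: rp mult.assoc)
  also have "ginv h * e = ginv h * (e * h) * ginv h"
    by (simp add: mult.assoc ginv_right[OF h_GL])
  also have "e * h = h * star e"
    by (simp add: mult_h)
  also have "ginv h * (h * star e) * ginv h = star e * ginv h"
    by (simp add: ginv_cancel[OF h_GL])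
  also have "e * (star e * ginv h) = (e * h) * ginv h"
    by (simp add: mult_h mult.assoc)
  also have "\<dots> = e"
    by (simp add: mult.assoc ginv_right[OF h_GL])
  finally show 2: "range_projection e * e = e" .
  have "star (range_projection e) = range_projection e"
    by (simp add: rp star_mult star_ginv_h c)
  moreover have "range_projection e * range_projection e = range_projection e"
    using 2 by (metis rp mult.assoc)
  ultimately show "projection (range_projection e)"
    by (simp add: projection_def)
qed

text \<open>Both projections generate the right ideal of \<open>e\<close>, so each fixes the other
  from the left; the adjoint of one of these relations identifies them.\<close>

lemma range_projection_unique:
  assumes q: "projection q" and "q * e = e" "e * q = q"
  shows "range_projection e = q"
proof -
  let ?p = "range_projection e"
  have "q * ?p = ?p"
    using assms mult_range_projection by (metis mult.assoc)
  moreover have "?p * q = q"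
    using assms range_projection_mult by (metis mult.assoc)
  ultimately have "star ?p = ?p * q" "?p * q = q"
    using q projection_range_projection by (metis projection_def star_mult)+
  then show ?thesis
    using projection_range_projection by (simp add: projection_def)
qed

end

lemma continuous_on_range_projection:
  fixes f :: "'b::topological_space \<Rightarrow> 'a::cstar_algebra"
  assumes "continuous_on S f" "\<And>x. x \<in> S \<Longrightarrow> f x * f x = f x"
  shows "continuous_on S (\<lambda>x. range_projection (f x))"
  unfolding range_projection_def
  by (intro continuous_on_mult continuous_on_ginv continuous_on_diff continuous_on_add
      continuous_on_star continuous_on_const assms idempotent_plus_star_GL)

subsection \<open>Complete tuples and resolutions of the identity\<close>

text \<open>Left multiplication by \<open>E i\<close> is meant to be the i-th coordinate map of the
  direct sum of the right ideals of the projections.\<close>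

definition resolves :: "'a::cstar_algebra ^ 'n \<Rightarrow> ('n \<Rightarrow> 'a) \<Rightarrow> bool"
  where "resolves P E \<longleftrightarrow> (\<Sum>i\<in>UNIV. E i) = 1 \<and> (\<forall>i. P $ i * E i = E i) \<and>
    (\<forall>i j. E i * P $ j = (if i = j then P $ j else 0))"

definition tuple_sum :: "'a::cstar_algebra ^ 'n \<Rightarrow> 'a"
  where "tuple_sum P = (\<Sum>i\<in>UNIV. P $ i)"

text \<open>The idempotent onto the right ideal of the i-th projection along the other summands.\<close>

definition oblique :: "'a::cstar_algebra ^ 'n \<Rightarrow> 'n \<Rightarrow> 'a"
  where "oblique P i = P $ i * ginv (tuple_sum P)"

lemma resolves_mult:
  assumes "resolves P E"
  shows "E i * E j = (if i = j then E i else 0)"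
proof -
  have "E i * E j = E i * (P $ j * E j)"
    using assms by (simp add: resolves_def)
  also have "\<dots> = (E i * P $ j) * E j"
    by (simp only: mult.assoc)
  also have "\<dots> = (if i = j then E i else 0)"
    using assms by (simp add: resolves_def)
  finally show ?thesis .
qed

lemma PP_projection: "P \<in> PP \<Longrightarrow> projection (P $ i)"
  by (simp add: PP_def nontrivial_projection_def)

lemma PP_simps:
  assumes "P \<in> PP"
  shows "star (P $ i) = P $ i" "P $ i * P $ i = P $ i" "P $ i * (P $ i * x) = P $ i * x"
  using PP_projection[OF assms, of i] by (simp_all add: projection_def flip: mult.assoc)

lemma star_tuple_sum: "P \<in> PP \<Longrightarrow> star (tuple_sum P) = tuple_sum P"
  by (simp add: tuple_sum_def star_sum PP_simps)

lemma PC_subset_PP: "PC \<subseteq> PP"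
  by (auto simp: PC_def)

lemma resolves_mult_tuple_sum:
  assumes "resolves P E"
  shows "E i * tuple_sum P = P $ i"
  using assms by (simp add: resolves_def tuple_sum_def sum_distrib_left)

text \<open>The inverse is \<open>B\<close>: since \<open>E i * tuple_sum P = P $ i\<close>, the
  i-th term of \<open>B * tuple_sum P\<close> is the adjoint of \<open>P $ i * E i = E i\<close>,
  and these adjoints sum to 1. Self-adjointness of both factors gives the other side.\<close>

lemma resolves_tuple_sum_GL:
  assumes "P \<in> PP" "resolves P E"
  shows "tuple_sum P \<in> GL"
proof -
  define B where "B = (\<Sum>i\<in>UNIV. star (E i) * E i)"
  have "star (E i) * E i * tuple_sum P = star (E i)" for i
  proof -
    have "star (E i) * E i * tuple_sum P = star (E i) * star (P $ i)"
      by (simp add: mult.assoc resolves_mult_tuple_sum[OF assms(2)] PP_simps[OF assms(1)])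
    also have "\<dots> = star (E i)"
      using assms(2) by (simp add: resolves_def flip: star_mult)
    finally show ?thesis .
  qed
  then have BA: "B * tuple_sum P = 1"
    using assms(2) by (simp add: B_def sum_distrib_right resolves_def star_one flip: star_sum)
  have "star B = B"
    by (simp add: B_def star_sum star_mult star_star)
  then have "tuple_sum P * B = 1"
    using arg_cong[OF BA, of star] assms(1) by (simp add: star_mult star_tuple_sum star_one)
  with BA show ?thesis
    by (rule ginv_unique(1)[rotated])
qed

lemma resolves_eq_oblique:
  assumes "P \<in> PP" "resolves P E"
  shows "E = oblique P"
proof
  fix i
  have "oblique P i = E i * tuple_sum P * ginv (tuple_sum P)"
    by (simp add: oblique_def resolves_mult_tuple_sum[OF assms(2)])
  then show "E i = oblique P i"
    by (simp add: mult.assoc ginv_right[OF resolves_tuple_sum_GL[OF assms]])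
qed

text \<open>The components of \<open>x\<close> are \<open>E i * x\<close>; applying
  \<open>E i\<close> to any decomposition recovers its i-th term.\<close>

lemma PC_if_resolves:
  assumes "P \<in> PP" and E: "resolves P E"
  shows "P \<in> PC"
proof -
  have "\<exists>!y. (\<forall>i. y i \<in> range (\<lambda>x. P $ i * x)) \<and> x = (\<Sum>i\<in>UNIV. y i)" for x
  proof (rule ex1I[of _ "\<lambda>i. E i * x"])
    have "E i * x = P $ i * (E i * x)" for i
      using E by (simp add: resolves_def flip: mult.assoc)
    moreover have "x = (\<Sum>i\<in>UNIV. E i * x)"
      using E by (simp add: resolves_def flip: sum_distrib_right)
    ultimately show "(\<forall>i. E i * x \<in> range (\<lambda>x. P $ i * x)) \<and> x = (\<Sum>i\<in>UNIV. E i * x)"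
      by blast
  next
    fix y assume y: "(\<forall>i. y i \<in> range (\<lambda>x. P $ i * x)) \<and> x = (\<Sum>i\<in>UNIV. y i)"
    have "E i * y j = (if i = j then y j else 0)" for i j
    proof -
      obtain z where "y j = P $ j * z"
        using y by blast
      then have "E i * y j = (E i * P $ j) * z"
        by (simp add: mult.assoc)
      with \<open>y j = P $ j * z\<close> show ?thesis
        using E by (simp add: resolves_def)
    qed
    then show "y = (\<lambda>i. E i * x)"
      using y by (simp add: sum_distrib_left)
  qed
  then show ?thesis
    using assms(1) by (simp add: PC_def direct_sum_decomposition_def)
qed

lemma direct_sum_unique:
  assumes "direct_sum_decomposition V" "\<And>i. y i \<in> V i" "\<And>i. z i \<in> V i"
    and "x = (\<Sum>i\<in>UNIV. y i)" "x = (\<Sum>i\<in>UNIV. z i)"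
  shows "y = z"
proof -
  have "\<exists>!y. (\<forall>i. y i \<in> V i) \<and> x = (\<Sum>i\<in>UNIV. y i)"
    using assms(1) by (simp add: direct_sum_decomposition_def)
  from this[unfolded Ex1_def] show ?thesis
    using assms(2-) by metis
qed

text \<open>Take for \<open>E\<close> the components of \<open>1\<close>. Then \<open>P $ j\<close>
  decomposes both as the sum of the \<open>E i * P $ j\<close> and trivially as itself, and
  uniqueness yields the relations.\<close>

lemma PC_resolves:
  assumes "P \<in> PC"
  shows "resolves P (oblique P)"
proof -
  have P: "P \<in> PP" and ds: "direct_sum_decomposition (\<lambda>i. range (\<lambda>x. P $ i * x))"
    using assms by (auto simp: PC_def)
  obtain E where E: "\<And>i. E i \<in> range (\<lambda>x. P $ i * x)" "1 = (\<Sum>i\<in>UNIV. E i)"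
    using ds[unfolded direct_sum_decomposition_def, rule_format, of 1] by (elim ex1E conjE) blast
  have PE: "P $ i * E i = E i" for i
    using E(1)[of i] PP_simps[OF P] by auto
  have EP: "(\<lambda>i. E i * P $ j) = (\<lambda>i. if i = j then P $ j else 0)" for j
  proof -
    have "E i * P $ j \<in> range (\<lambda>x. P $ i * x)" for i
      by (rule range_eqI[of _ _ "E i * P $ j"]) (simp add: PE flip: mult.assoc)
    moreover have "P $ j = (\<Sum>i\<in>UNIV. E i * P $ j)"
      by (simp flip: sum_distrib_right E(2))
    moreover have "(if i = j then P $ j else 0) \<in> range (\<lambda>x. P $ i * x)" for i
      by (rule range_eqI[of _ _ "if i = j then P $ j else 0"]) (simp add: PP_simps[OF P])
    moreover have "P $ j = (\<Sum>i\<in>UNIV. if i = j then P $ j else 0)"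
      by simp
    ultimately show ?thesis
      by (intro direct_sum_unique[OF ds]) auto
  qed
  have "resolves P E"
    using E(2) PE EP by (simp add: resolves_def fun_eq_iff)
  then show ?thesis
    using resolves_eq_oblique[OF P] by simp
qed

lemma PC_tuple_sum_GL: "P \<in> PC \<Longrightarrow> tuple_sum P \<in> GL"
  using PC_resolves PC_subset_PP resolves_tuple_sum_GL by blast

text \<open>Turns the direct sum condition into equations between continuous functions on
  \<open>PI\<close>, so that closedness can be read off.\<close>

lemma PC_iff:
  "P \<in> PC \<longleftrightarrow> P \<in> PI \<and>
     (\<forall>i j. P $ i * ginv (tuple_sum P) * P $ j = (if i = j then P $ j else 0))"
proof
  assume P: "P \<in> PC"
  then show "P \<in> PI \<and> (\<forall>i j. P $ i * ginv (tuple_sum P) * P $ j = (if i = j then P $ j else 0))"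
    using PC_resolves[OF P] PC_tuple_sum_GL[OF P] PC_subset_PP
    by (auto simp: PI_def resolves_def oblique_def tuple_sum_def)
next
  assume P: "P \<in> PI \<and> (\<forall>i j. P $ i * ginv (tuple_sum P) * P $ j = (if i = j then P $ j else 0))"
  then have "P \<in> PP" "tuple_sum P \<in> GL"
    by (auto simp: PI_def tuple_sum_def)
  moreover have "(\<Sum>i\<in>UNIV. oblique P i) = 1"
    unfolding oblique_def using ginv_right[OF \<open>tuple_sum P \<in> GL\<close>]
    by (simp add: tuple_sum_def flip: sum_distrib_right)
  ultimately have "resolves P (oblique P)"
    using P by (simp add: resolves_def oblique_def PP_simps)
  then show "P \<in> PC"
    by (rule PC_if_resolves[OF \<open>P \<in> PP\<close>])
qed

section \<open>Openness of the invertible tuples and closedness of the complete ones\<close>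

lemma continuous_on_tuple_sum: "continuous_on S tuple_sum"
  unfolding tuple_sum_def by (intro continuous_intros)

lemma continuous_on_oblique:
  assumes "continuous_on S f" "\<And>x. x \<in> S \<Longrightarrow> f x \<in> PC"
  shows "continuous_on S (\<lambda>x. oblique (f x) i)"
  unfolding oblique_def
  using assms by (intro continuous_on_mult continuous_on_ginv continuous_on_component
      continuous_on_compose2[OF continuous_on_tuple_sum]) (auto intro: PC_tuple_sum_GL)

lemma openin_PI: "openin (top_of_set PP) (PI :: ('a::cstar_algebra ^ 'n) set)"
proof -
  have "open (tuple_sum -` GL :: ('a ^ 'n) set)"
    by (rule open_vimage[OF open_GL continuous_on_tuple_sum])
  then have "openin (top_of_set PP) (PP \<inter> tuple_sum -` GL :: ('a ^ 'n) set)"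
    by (rule openin_open_Int)
  moreover have "PI = (PP \<inter> tuple_sum -` GL :: ('a ^ 'n) set)"
    by (auto simp: PI_def tuple_sum_def)
  ultimately show ?thesis
    by simp
qed

lemma closedin_PC: "closedin (top_of_set PI) (PC :: ('a::cstar_algebra ^ 'n) set)"
proof -
  have cont: "continuous_on PI (\<lambda>P :: 'a ^ 'n. P $ i * ginv (tuple_sum P) * P $ j
      - (if i = j then P $ j else 0))"
    for i j
    by (cases "i = j") (auto intro!: continuous_intros continuous_on_ginv continuous_on_tuple_sum
        simp: PI_def tuple_sum_def)
  have eq: "PC = PI \<inter> (\<Inter>i. \<Inter>j. PI \<inter>
      (\<lambda>P :: 'a ^ 'n. P $ i * ginv (tuple_sum P) * P $ j - (if i = j then P $ j else 0)) -` {0})"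
    by (simp add: PC_iff set_eq_iff)
  show ?thesis
    by (subst eq) (intro closedin_Int closedin_INT continuous_closedin_preimage cont; auto)
qed

subsection \<open>Moving complete tuples by similarities\<close>

definition move :: "'a::cstar_algebra \<Rightarrow> 'a ^ 'n \<Rightarrow> 'a ^ 'n"
  where "move D P = (\<chi> i. range_projection (D * oblique P i * ginv D))"

lemma oblique_mult: "P \<in> PC \<Longrightarrow> oblique P i * oblique P j = (if i = j then oblique P i else 0)"
  by (rule resolves_mult[OF PC_resolves])

lemma conj_oblique_mult:
  assumes "P \<in> PC" "D \<in> GL"
  shows "(D * oblique P i * ginv D) * (D * oblique P j * ginv D)
    = (if i = j then D * oblique P i * ginv D else 0)"
proof -
  have "(D * oblique P i * ginv D) * (D * oblique P j * ginv D)
      = D * (oblique P i * oblique P j) * ginv D"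
    by (simp add: mult.assoc ginv_cancel[OF assms(2)])
  then show ?thesis
    by (simp add: oblique_mult[OF assms(1)])
qed

lemma sum_conj_oblique:
  assumes "P \<in> PC" "D \<in> GL"
  shows "(\<Sum>i\<in>UNIV. D * oblique P i * ginv D) = 1"
  using PC_resolves[OF assms(1)] ginv_right[OF assms(2)]
  by (simp add: resolves_def flip: sum_distrib_left sum_distrib_right)

lemma move_PC:
  assumes "P \<in> PC" "D \<in> GL"
  shows "move D P \<in> PC"
proof (rule PC_if_resolves[of _ "\<lambda>i. D * oblique P i * ginv D"])
  let ?e = "\<lambda>i. D * oblique P i * ginv D"
  have idem: "?e i * ?e i = ?e i" for i
    by (simp only: conj_oblique_mult[OF assms] if_True simp_thms)
  note rp = projection_range_projection[OF idem] range_projection_mult[OF idem]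
    mult_range_projection[OF idem]
  \<comment> \<open>Undoing the conjugation fixes \<open>0\<close> and \<open>1\<close>, so a
    trivial conjugate would force \<open>P $ i\<close> to be trivial.\<close>
  have unconj: "ginv D * (D * oblique P i * ginv D) * D = oblique P i" for i
    by (simp add: mult.assoc ginv_cancel[OF assms(2)] ginv[OF assms(2)])
  have "?e i \<noteq> 0" for i
  proof
    assume "?e i = 0"
    then have "oblique P i = 0"
      using unconj[of i] by simp
    moreover have "oblique P i * P $ i = P $ i"
      using PC_resolves[OF assms(1)] by (simp add: resolves_def)
    ultimately show False
      using assms(1) by (auto simp: PC_def PP_def nontrivial_projection_def)
  qed
  moreover have "?e i \<noteq> 1" for i
  proof
    assume "?e i = 1"
    then have "oblique P i = 1"
      using unconj[of i] by (simp add: ginv[OF assms(2)])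
    moreover have "P $ i * oblique P i = oblique P i"
      using PC_resolves[OF assms(1)] by (simp add: resolves_def)
    ultimately show False
      using assms(1) by (auto simp: PC_def PP_def nontrivial_projection_def)
  qed
  ultimately have "nontrivial_projection (range_projection (?e i))" for i
    using rp[of i] by (auto simp: nontrivial_projection_def)
  then show "move D P \<in> PP"
    by (simp add: PP_def move_def)
  have "?e i * range_projection (?e j) = (if i = j then range_projection (?e j) else 0)" for i j
  proof -
    have "?e i * range_projection (?e j) = (?e i * ?e j) * range_projection (?e j)"
      by (simp only: mult.assoc[of "?e i" "?e j"] rp(3))
    also have "\<dots> = (if i = j then range_projection (?e j) else 0)"
      by (simp only: conj_oblique_mult[OF assms]) (auto simp: rp(3))
    finally show ?thesis .
  qed
  then show "resolves (move D P) ?e"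
    by (simp add: resolves_def move_def sum_conj_oblique[OF assms] rp(2))
qed

text \<open>A complete tuple is recovered from its oblique idempotents as their range
  projections.\<close>

lemma move_eqI:
  assumes "P \<in> PC" "D \<in> GL" "Q \<in> PC" "\<And>i. D * oblique P i * ginv D = oblique Q i"
  shows "move D P = Q"
proof -
  have "range_projection (oblique Q i) = Q $ i" for i
    using PC_resolves[OF assms(3)] assms(3) PC_subset_PP
    by (intro range_projection_unique) (auto simp: oblique_mult resolves_def PP_projection)
  then show ?thesis
    by (simp add: move_def vec_eq_iff assms(4))
qed

lemma continuous_on_move:
  assumes "continuous_on S f" "continuous_on S g"
    "\<And>x. x \<in> S \<Longrightarrow> f x \<in> GL" "\<And>x. x \<in> S \<Longrightarrow> g x \<in> PC"
  shows "continuous_on S (\<lambda>x. move (f x) (g x))"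
  unfolding move_def
  using assms by (intro continuous_on_vec_lambda continuous_on_range_projection continuous_on_mult
      continuous_on_ginv continuous_on_oblique) (simp_all add: conj_oblique_mult)

subsection \<open>Orthogonalisation\<close>

lemma PO_subset_PC: "PO \<subseteq> PC"
proof
  fix P :: "'a ^ 'n" assume P: "P \<in> PO"
  then have "P \<in> PP"
    by (simp add: PO_def)
  with P show "P \<in> PC"
    by (intro PC_if_resolves[of _ "\<lambda>i. P $ i"]) (auto simp: PO_def resolves_def PP_simps)
qed

lemma tuple_sum_PO: "P \<in> PO \<Longrightarrow> tuple_sum P = 1"
  by (simp add: PO_def tuple_sum_def)

lemma oblique_PO: "P \<in> PO \<Longrightarrow> oblique P i = P $ i"
  by (simp add: oblique_def tuple_sum_PO ginv_one)

lemma move_PO_commute: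
  assumes "P \<in> PO" "D \<in> GL" "\<And>i. D * P $ i = P $ i * D"
  shows "move D P = P"
  using assms PO_subset_PC
  by (intro move_eqI) (auto simp: oblique_PO mult.assoc ginv_right)

lemma move_one:
  assumes "P \<in> PC"
  shows "move 1 P = P"
  using assms by (intro move_eqI GL_one) (simp_all add: ginv_one)

text \<open>The scaling makes \<open>1 - gram P\<close> an average of the projections
  \<open>1 - P $ i\<close>, hence an element of the closed unit ball, where the square root series
  converges.\<close>

definition gram :: "'a::cstar_algebra ^ 'n \<Rightarrow> 'a"
  where "gram P = inverse (real CARD('n)) *\<^sub>R tuple_sum P"

definition gram_sqrt :: "'a::cstar_algebra ^ 'n \<Rightarrow> 'a"
  where "gram_sqrt P = binomial_sqrt (gram P)"

text \<open>This bound replaces positivity of the sum of the projections.\<close>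

lemma norm_one_minus_gram:
  fixes P :: "'a::cstar_algebra ^ 'n"
  assumes "P \<in> PP"
  shows "norm (1 - gram P) \<le> 1"
proof -
  have "1 - gram P = inverse (real CARD('n)) *\<^sub>R (\<Sum>i\<in>UNIV. 1 - P $ i)"
    by (simp add: gram_def tuple_sum_def sum_subtractf sum_constant_scaleR scaleR_diff_right
        del: sum_constant)
  also have "norm \<dots> \<le> inverse (real CARD('n)) * (\<Sum>i\<in>UNIV. norm (1 - P $ i))"
    by (simp add: norm_sum)
  also have "\<dots> \<le> inverse (real CARD('n)) * (\<Sum>i\<in>(UNIV :: 'n set). 1)"
    using assms
    by (intro mult_left_mono sum_mono norm_projection_le_1 projection_one_minus PP_projection) auto
  also have "\<dots> = 1"
    by simp
  finally show ?thesis .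
qed

lemma star_gram: "P \<in> PP \<Longrightarrow> star (gram P) = gram P"
  by (simp add: gram_def star_scaleR star_tuple_sum)

lemma gram_GL: "P \<in> PC \<Longrightarrow> gram P \<in> GL"
  unfolding gram_def by (intro GL_scaleR PC_tuple_sum_GL) auto

lemma
  assumes "P \<in> PC"
  shows gram_sqrt_square: "gram_sqrt P * gram_sqrt P = gram P"
    and star_gram_sqrt: "star (gram_sqrt P) = gram_sqrt P"
    and gram_sqrt_GL: "gram_sqrt P \<in> GL"
    and norm_one_minus_gram_sqrt: "norm (1 - gram_sqrt P) \<le> 1"
proof -
  have P: "P \<in> PP"
    using assms PC_subset_PP by blast
  note n = norm_one_minus_gram[OF P]
  show "gram_sqrt P * gram_sqrt P = gram P" "star (gram_sqrt P) = gram_sqrt P"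
    "gram_sqrt P \<in> GL" "norm (1 - gram_sqrt P) \<le> 1"
    unfolding gram_sqrt_def
    by (rule binomial_sqrt_square[OF n] star_binomial_sqrt[OF n star_gram[OF P]]
        binomial_sqrt_GL[OF n gram_GL[OF assms]] norm_one_minus_binomial_sqrt[OF n])+
qed

lemma continuous_on_gram_sqrt: "continuous_on PC gram_sqrt"
  unfolding gram_sqrt_def gram_def
  by (intro continuous_on_compose2[OF continuous_on_binomial_sqrt] continuous_on_scaleR
      continuous_on_const continuous_on_tuple_sum)
     (use norm_one_minus_gram PC_subset_PP in \<open>auto simp: gram_def\<close>)

definition orthogonalise :: "'a::cstar_algebra ^ 'n \<Rightarrow> 'a ^ 'n"
  where "orthogonalise P = move (ginv (gram_sqrt P)) P"

text \<open>As \<open>tuple_sum P\<close> is a multiple of the square of \<open>gram_sqrt P\<close>,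
  one factor of its inverse cancels; what remains is visibly self-adjoint.\<close>

lemma conj_oblique_gram_sqrt:
  fixes P :: "'a::cstar_algebra ^ 'n"
  assumes "P \<in> PC"
  shows "ginv (gram_sqrt P) * oblique P i * gram_sqrt P =
    inverse (real CARD('n)) *\<^sub>R (ginv (gram_sqrt P) * P $ i * ginv (gram_sqrt P))"
proof -
  let ?R = "gram_sqrt P"
  note R = gram_sqrt_GL[OF assms]
  have "tuple_sum P = real CARD('n) *\<^sub>R (?R * ?R)"
    by (simp add: gram_sqrt_square[OF assms] gram_def)
  then have "ginv (tuple_sum P) = inverse (real CARD('n)) *\<^sub>R (ginv ?R * ginv ?R)"
    by (simp add: GL_scaleR GL_mult R)
  then show ?thesis
    by (simp add: oblique_def mult.assoc ginv_left[OF R])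
qed

text \<open>A self-adjoint idempotent is its own range projection. The conjugation form gives
  orthogonality, the scaled form gives congruence to \<open>P\<close>.\<close>

lemma orthogonalise_nth:
  fixes P :: "'a::cstar_algebra ^ 'n"
  assumes "P \<in> PC"
  shows orthogonalise_nth_conj:
      "orthogonalise P $ i = ginv (gram_sqrt P) * oblique P i * ginv (ginv (gram_sqrt P))"
    and orthogonalise_nth_scaleR: "orthogonalise P $ i =
      inverse (real CARD('n)) *\<^sub>R (ginv (gram_sqrt P) * P $ i * ginv (gram_sqrt P))"
proof -
  let ?D = "ginv (gram_sqrt P)"
  let ?e = "?D * oblique P i * ginv ?D"
  have D: "?D \<in> GL" "ginv ?D = gram_sqrt P"
    by (rule GL_ginv[OF gram_sqrt_GL[OF assms]])+
  have e: "?e = inverse (real CARD('n)) *\<^sub>R (?D * P $ i * ?D)"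
    by (simp only: D(2) conj_oblique_gram_sqrt[OF assms])
  have "star ?D = ?D"
    using GL_star(2)[OF gram_sqrt_GL[OF assms]] by (simp add: star_gram_sqrt[OF assms])
  moreover have "star (P $ i) = P $ i"
    using assms PC_subset_PP by (auto simp: PP_simps)
  ultimately have "star ?e = ?e"
    unfolding e by (simp add: star_scaleR star_mult mult.assoc)
  moreover have idem: "?e * ?e = ?e"
    using conj_oblique_mult[OF assms D(1), of i i] by simp
  ultimately have "range_projection ?e = ?e"
    by (intro range_projection_unique) (simp_all only: projection_def simp_thms)
  then show "orthogonalise P $ i = ?e"
    by (simp add: orthogonalise_def move_def)
  with e show "orthogonalise P $ i = inverse (real CARD('n)) *\<^sub>R (?D * P $ i * ?D)"
    by simp
qed

lemma orthogonalise_PO: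
  assumes "P \<in> PC"
  shows "orthogonalise P \<in> PO"
proof -
  have D: "ginv (gram_sqrt P) \<in> GL"
    by (intro GL_ginv gram_sqrt_GL assms)
  have "orthogonalise P \<in> PP"
    using move_PC[OF assms D] PC_subset_PP by (auto simp: orthogonalise_def)
  then show ?thesis
    using sum_conj_oblique[OF assms D] conj_oblique_mult[OF assms D]
    by (simp add: PO_def orthogonalise_nth_conj[OF assms])
qed

lemma continuous_on_orthogonalise: "continuous_on PC orthogonalise"
  unfolding orthogonalise_def
  by (intro continuous_on_move continuous_on_ginv continuous_on_gram_sqrt continuous_on_id)
     (auto intro: GL_ginv gram_sqrt_GL)

section \<open>The deformation onto orthogonal tuples\<close>

definition gram_path :: "real \<Rightarrow> 'a::cstar_algebra ^ 'n \<Rightarrow> 'a"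
  where "gram_path t P = (1 - t) *\<^sub>R 1 + t *\<^sub>R gram_sqrt P"

lemma gram_path_GL:
  assumes "P \<in> PC" "t \<in> {0..1}"
  shows "gram_path t P \<in> GL"
  using assms unfolding gram_path_def
  by (intro convex_combination_GL gram_sqrt_GL norm_one_minus_gram_sqrt) auto

text \<open>On \<open>PO\<close> the sum is \<open>1\<close>, so \<open>gram P\<close> is scalar and
  the whole path is central.\<close>

lemma move_gram_path_PO:
  fixes P :: "'a::cstar_algebra ^ 'n"
  assumes "P \<in> PO" "t \<in> {0..1}"
  shows "move (ginv (gram_path t P)) P = P"
proof -
  have P: "P \<in> PC" "P \<in> PP"
    using assms(1) PO_subset_PC PC_subset_PP by auto
  have "gram_sqrt P * x = x * gram_sqrt P" for x
    unfolding gram_sqrt_def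
    by (rule binomial_sqrt_commute[OF norm_one_minus_gram[OF P(2)]])
       (simp add: gram_def tuple_sum_PO[OF assms(1)])
  then have "gram_path t P * x = x * gram_path t P" for x
    by (simp add: gram_path_def algebra_simps)
  then show ?thesis
    using gram_path_GL[OF P(1) assms(2)]
    by (intro move_PO_commute assms(1) GL_ginv ginv_commute)
qed

lemma PO_strong_deformation_retract_of_PC:
  "(PO :: ('a::cstar_algebra ^ 'n) set) strong_deformation_retract_of PC"
proof -
  define H :: "real \<times> ('a ^ 'n) \<Rightarrow> 'a ^ 'n" where "H = (\<lambda>(t, P). move (ginv (gram_path t P)) P)"
  have "continuous_on ({0..1} \<times> PC) (\<lambda>x. gram_path (fst x) (snd x :: 'a ^ 'n))"
    unfolding gram_path_def
    by (intro continuous_intros continuous_on_compose2[OF continuous_on_gram_sqrt]) auto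
  then have "continuous_on ({0..1} \<times> PC) H"
    unfolding H_def case_prod_unfold
    by (intro continuous_on_move continuous_on_ginv continuous_intros)
       (auto intro!: gram_path_GL GL_ginv)
  moreover have "H \<in> {0..1} \<times> PC \<rightarrow> PC"
    by (auto simp: H_def intro!: move_PC GL_ginv gram_path_GL)
  ultimately have cont: "continuous_map (prod_topology (top_of_set {0..1}) (top_of_set PC))
      (top_of_set PC) H"
    by simp
  have H0: "H (0, P) = P" and H1: "H (1, P) = orthogonalise P" if "P \<in> PC" for P
    using that by (simp_all add: H_def gram_path_def ginv_one move_one orthogonalise_def)
  have HPO: "H (t, P) = P" if "P \<in> PO" "t \<in> {0..1}" for t P
    using that by (simp add: H_def move_gram_path_PO)
  \<comment> \<open>The side condition of the homotopy must depend only on values on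
    \<open>PC\<close>; it does, since \<open>PO\<close> lies in \<open>PC\<close>.\<close>
  have restrict: "(\<forall>x\<in>PO. h x = x) \<longleftrightarrow> (\<forall>x\<in>PO. k x = x)"
    if "\<And>x. x \<in> topspace (top_of_set PC) \<Longrightarrow> h x = k x" for h k :: "'a ^ 'n \<Rightarrow> 'a ^ 'n"
    using that PO_subset_PC by (metis subsetD topspace_euclidean_subtopology)
  have "homotopic_with_canon (\<lambda>h. \<forall>x\<in>PO. h x = x) PC PC id (orthogonalise :: 'a ^ 'n \<Rightarrow> _)"
    by (rule homotopic_with[OF restrict, THEN iffD2], blast, intro exI[of _ H] conjI cont)
       (use H0 H1 HPO in simp_all)
  moreover have "orthogonalise P = P" if "P \<in> PO" for P :: "'a ^ 'n"
    using move_gram_path_PO[OF that, of 1] by (simp add: gram_path_def orthogonalise_def)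
  then have "retraction PC PO (orthogonalise :: 'a ^ 'n \<Rightarrow> 'a ^ 'n)"
    using PO_subset_PC continuous_on_orthogonalise orthogonalise_PO
    by (auto simp: retraction_def)
  ultimately show ?thesis
    unfolding strong_deformation_retract_of_def by blast
qed

subsection \<open>Local sections of the similarity action\<close>

text \<open>On the i-th right ideal of a complete \<open>P\<close> this acts as left multiplication
  by \<open>Q $ i\<close>; it is \<open>1\<close> at \<open>Q = P\<close>.\<close>

definition transfer :: "'a::cstar_algebra ^ 'n \<Rightarrow> 'a ^ 'n \<Rightarrow> 'a"
  where "transfer P Q = (\<Sum>i\<in>UNIV. Q $ i * oblique P i)"

text \<open>\<open>QP + (1 - Q)(1 - P)\<close> intertwines the projections \<open>P\<close> and \<open>Q\<close>, so its invertibility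
  gives \<open>QA = QPA\<close>: the transfer element maps the right ideals of \<open>P\<close> onto those of \<open>Q\<close>.\<close>

definition nearby :: "'a::cstar_algebra ^ 'n \<Rightarrow> ('a ^ 'n) set"
  where "nearby P = {Q. transfer P Q \<in> GL \<and>
    (\<forall>i. Q $ i * P $ i + (1 - Q $ i) * (1 - P $ i) \<in> GL)}"

lemma continuous_on_transfer: "continuous_on S (transfer P)"
  unfolding transfer_def by (intro continuous_intros)

lemma transfer_self: "P \<in> PC \<Longrightarrow> transfer P P = 1"
  using PC_resolves[of P] by (simp add: transfer_def resolves_def)

lemma open_nearby: "open (nearby P)"
proof -
  have "nearby P = transfer P -` GL \<inter>
      (\<Inter>i\<in>UNIV. (\<lambda>Q. Q $ i * P $ i + (1 - Q $ i) * (1 - P $ i)) -` GL)"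
    by (auto simp: nearby_def)
  also have "open \<dots>"
    by (intro open_Int open_INT ballI open_vimage open_GL continuous_on_transfer continuous_intros)
       simp
  finally show ?thesis .
qed

lemma self_in_nearby:
  assumes "P \<in> PC"
  shows "P \<in> nearby P"
proof -
  have "P \<in> PP"
    using assms PC_subset_PP by blast
  then show ?thesis
    by (simp add: nearby_def transfer_self[OF assms] GL_one algebra_simps PP_simps)
qed

text \<open>The conjugates of the oblique idempotents of \<open>P\<close> by the transfer element
  resolve \<open>Q\<close>.\<close>

lemma nearby_PC:
  assumes P: "P \<in> PC" and Q: "Q \<in> PP" "Q \<in> nearby P"
  shows "Q \<in> PC" "move (transfer P Q) P = Q"
proof -
  let ?W = "transfer P Q"
  let ?F = "\<lambda>i. ?W * oblique P i * ginv ?W"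
  have W: "?W \<in> GL"
    using Q by (simp add: nearby_def)
  have PP: "P \<in> PP"
    using P PC_subset_PP by blast
  have "?W * oblique P i = (\<Sum>j\<in>UNIV. Q $ j * (oblique P j * oblique P i))" for i
    by (simp add: transfer_def sum_distrib_right mult.assoc)
  then have We: "?W * oblique P i = Q $ i * oblique P i" for i
    by (simp add: oblique_mult[OF P] if_distrib cong: if_cong)
  have QF: "Q $ i * ?F i = ?F i" for i
  proof -
    have "Q $ i * ?F i = Q $ i * (Q $ i * oblique P i) * ginv ?W"
      by (simp only: We mult.assoc)
    also have "\<dots> = ?F i"
      by (simp only: PP_simps[OF Q(1)] We)
    finally show ?thesis .
  qed
  \<comment> \<open>Multiplying \<open>T\<close> by \<open>Q $ i\<close> kills its second summand,
    so \<open>Q $ i\<close> equals \<open>Q $ i * P $ i * ginv T\<close>, which begins with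
    \<open>?W * oblique P i\<close>.\<close>
  have Q_fac: "\<exists>x. Q $ i = ?W * oblique P i * x" for i
  proof -
    define T where "T = Q $ i * P $ i + (1 - Q $ i) * (1 - P $ i)"
    have T: "T \<in> GL"
      using Q by (simp add: T_def nearby_def)
    have "Q $ i * T = Q $ i * P $ i"
      by (simp add: T_def algebra_simps PP_simps[OF Q(1)])
    also have "P $ i = oblique P i * P $ i"
      using PC_resolves[OF P] by (simp add: resolves_def)
    also have "Q $ i * (oblique P i * P $ i) = ?W * oblique P i * P $ i"
      by (simp add: We mult.assoc)
    finally have "Q $ i * T * ginv T = ?W * oblique P i * P $ i * ginv T"
      by simp
    then have "Q $ i = ?W * oblique P i * (P $ i * ginv T)"
      by (simp add: mult.assoc ginv_right[OF T])
    then show ?thesis ..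
  qed
  have FQ: "?F i * Q $ j = (if i = j then Q $ j else 0)" for i j
  proof -
    obtain x where x: "Q $ j = ?W * oblique P j * x"
      using Q_fac by blast
    have "?F i * (?W * oblique P j * x) = ?W * (oblique P i * oblique P j) * x"
      by (simp add: mult.assoc ginv_cancel[OF W])
    also have "\<dots> = (if i = j then ?W * oblique P j * x else 0)"
      by (simp add: oblique_mult[OF P])
    finally show ?thesis
      by (simp only: x)
  qed
  have res: "resolves Q ?F"
    unfolding resolves_def using sum_conj_oblique[OF P W] QF FQ by blast
  show QPC: "Q \<in> PC"
    by (rule PC_if_resolves[OF Q(1) res])
  show "move ?W P = Q"
    using fun_cong[OF resolves_eq_oblique[OF Q(1) res]] by (intro move_eqI P W QPC)
qed

section \<open>Openness and local path-connectedness of the complete tuples\<close>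

lemma PC_subset_PI: "PC \<subseteq> PI"
  by (auto simp: PC_iff)

lemma openin_PC: "openin (top_of_set PI) (PC :: ('a::cstar_algebra ^ 'n) set)"
proof (subst openin_subopen, intro ballI exI conjI)
  fix P :: "'a ^ 'n" assume P: "P \<in> PC"
  show "openin (top_of_set PI) (PI \<inter> nearby P)"
    by (rule openin_open_Int[OF open_nearby])
  show "P \<in> PI \<inter> nearby P"
    using P self_in_nearby PC_subset_PI by blast
  show "PI \<inter> nearby P \<subseteq> PC"
    using nearby_PC(1)[OF P] by (auto simp: PI_def)
qed

text \<open>\<open>transfer P\<close> is a local section of the orbit map at \<open>P\<close>. Hence
  the image of a small ball around \<open>1\<close>, path-connected by convexity, contains a
  relatively open neighbourhood of \<open>P\<close>.\<close>

lemma locally_path_connected_PC: "locally path_connected (PC :: ('a::cstar_algebra ^ 'n) set)"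
proof (rule locallyI)
  fix w and P :: "'a ^ 'n"
  assume w: "openin (top_of_set PC) w" and "P \<in> w"
  then have P: "P \<in> PC"
    using openin_imp_subset by blast
  have cont: "continuous_on GL (\<lambda>D. move D P)"
    by (intro continuous_on_move continuous_on_id continuous_on_const P)
  have "openin (top_of_set GL) (GL \<inter> (\<lambda>D. move D P) -` w)"
    by (rule continuous_openin_preimage[OF cont _ w]) (use move_PC[OF P] in auto)
  then have "open (GL \<inter> (\<lambda>D. move D P) -` w)"
    using open_GL openin_open_eq by blast
  moreover have "1 \<in> GL \<inter> (\<lambda>D. move D P) -` w"
    using \<open>P \<in> w\<close> by (simp add: GL_one move_one[OF P])
  ultimately obtain r where r: "r > 0" "ball 1 r \<subseteq> GL \<inter> (\<lambda>D. move D P) -` w"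
    using open_contains_ball by blast
  let ?U = "PC \<inter> (nearby P \<inter> transfer P -` ball 1 r)" and ?V = "(\<lambda>D. move D P) ` ball 1 r"
  have "openin (top_of_set PC) ?U"
    by (intro openin_open_Int open_Int open_nearby open_vimage open_ball continuous_on_transfer)
  moreover have "path_connected ?V"
    using r(2) by (intro path_connected_continuous_image continuous_on_subset[OF cont]
        convex_imp_path_connected convex_ball) auto
  moreover have "P \<in> ?U"
    using P r(1) by (simp add: self_in_nearby transfer_self)
  moreover have "?U \<subseteq> ?V"
  proof
    fix Q assume Q: "Q \<in> ?U"
    then have "Q = move (transfer P Q) P"
      using nearby_PC(2)[OF P] PC_subset_PP by (auto dest: sym)
    then show "Q \<in> ?V"
      using Q by auto
  qed
  moreover have "?V \<subseteq> w"
    using r(2) by auto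
  ultimately show "\<exists>U V. openin (top_of_set PC) U \<and> path_connected V \<and> P \<in> U \<and> U \<subseteq> V \<and> V \<subseteq> w"
    by blast
qed

subsection \<open>Congruence and connected components\<close>

definition congruent_tuples :: "'a::cstar_algebra ^ 'n \<Rightarrow> 'a ^ 'n \<Rightarrow> bool"
  where "congruent_tuples P Q \<longleftrightarrow> (\<exists>D\<in>GL0. \<forall>i. P $ i = star D * Q $ i * D)"

lemma congruent_tuples_sym:
  assumes "congruent_tuples P Q"
  shows "congruent_tuples Q P"
proof -
  obtain D where D: "D \<in> GL0" "\<And>i. P $ i = star D * Q $ i * D"
    using assms by (auto simp: congruent_tuples_def)
  then have "D \<in> GL"
    using GL0_subset_GL by blast
  then have "star (ginv D) * P $ i * ginv D = Q $ i" for i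
    using ginv_cancel(2)[OF GL_star(1)]
    by (simp add: D(2) mult.assoc ginv_right GL_star flip: GL_star(2))
  then show ?thesis
    unfolding congruent_tuples_def by (intro bexI[OF _ GL0_ginv[OF D(1)]]) simp
qed

lemma congruent_tuples_trans:
  assumes "congruent_tuples P Q" "congruent_tuples Q S"
  shows "congruent_tuples P S"
proof -
  obtain D1 where D1: "D1 \<in> GL0" "\<And>i. P $ i = star D1 * Q $ i * D1"
    using assms(1) by (auto simp: congruent_tuples_def)
  obtain D2 where D2: "D2 \<in> GL0" "\<And>i. Q $ i = star D2 * S $ i * D2"
    using assms(2) by (auto simp: congruent_tuples_def)
  have "P $ i = star (D2 * D1) * S $ i * (D2 * D1)" for i
    by (simp add: D1(2) D2(2) star_mult mult.assoc)
  then show ?thesis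
    using GL0_mult[OF D2(1) D1(1)] by (auto simp: congruent_tuples_def)
qed

text \<open>Solve the scaled form of \<open>orthogonalise P\<close> for \<open>P\<close>. The factor
  lies in \<open>GL0\<close> because \<open>gram_sqrt P\<close> is invertible within distance 1 of
  \<open>1\<close> and \<open>?s\<close> is a positive scalar.\<close>

lemma congruent_orthogonalise:
  fixes P :: "'a::cstar_algebra ^ 'n"
  assumes "P \<in> PC"
  shows "congruent_tuples P (orthogonalise P)"
proof -
  let ?R = "gram_sqrt P" and ?s = "sqrt (real CARD('n))"
  let ?D = "?s *\<^sub>R 1 * ?R"
  note R = gram_sqrt_GL[OF assms]
  have "?D \<in> GL0"
    using R norm_one_minus_gram_sqrt[OF assms]
    by (intro GL0_mult GL0_of_real_pos GL0_if_near_one) auto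
  moreover have "P $ i = star ?D * orthogonalise P $ i * ?D" for i
  proof -
    have "star ?D * orthogonalise P $ i * ?D
        = (?s * ?s) *\<^sub>R (?R * orthogonalise P $ i * ?R)"
      by (simp add: star_scaleR star_gram_sqrt[OF assms])
    also have "\<dots> = P $ i"
      by (simp add: orthogonalise_nth_scaleR[OF assms] mult.assoc ginv_left[OF R] ginv_cancel[OF R])
    finally show ?thesis ..
  qed
  ultimately show ?thesis
    unfolding congruent_tuples_def by blast
qed

text \<open>Nearby orthogonal resolutions are intertwined by W = transfer P Q, and the
  unitary part of the polar decomposition of W intertwines them as well.\<close>

lemma PO_locally_congruent:
  fixes P :: "'a::cstar_algebra ^ 'n"
  assumes P: "P \<in> PO"
  shows "\<exists>T. open T \<and> P \<in> T \<and> (\<forall>Q\<in>T \<inter> PO. congruent_tuples P Q)"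
proof (intro exI conjI ballI)
  \<comment> \<open>The first bound puts the transfer element into \<open>GL0\<close>, the second
    provides a square root of \<open>star W * W\<close>.\<close>
  let ?T = "transfer P -` {W. norm (1 - W) < 1 \<and> norm (1 - star W * W) < 1}"
  have "open {W :: 'a. norm (1 - W) < 1 \<and> norm (1 - star W * W) < 1}"
    by (intro open_Collect_conj open_Collect_less continuous_intros continuous_on_star)
  then show "open ?T"
    by (intro open_vimage continuous_on_transfer)
  show "P \<in> ?T"
    using P PO_subset_PC by (auto simp: transfer_self star_one)
  fix Q assume Q: "Q \<in> ?T \<inter> PO"
  have PP: "P \<in> PP" "Q \<in> PP"
    using P Q by (auto simp: PO_def)
  define W where "W = transfer P Q"
  define h where "h = star W * W"
  have W: "W \<in> GL0"
    using Q by (intro GL0_if_near_one GL_if_near_one) (auto simp: W_def)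
  then have WG: "W \<in> GL"
    using GL0_subset_GL by blast
  have h: "norm (1 - h) \<le> 1" "h \<in> GL" "star h = h"
    using Q GL_mult(1)[OF GL_star(1)[OF WG] WG]
    by (auto simp: W_def h_def star_mult star_star)
  have "W * P $ i = Q $ i * P $ i" "Q $ i * W = Q $ i * P $ i" for i
  proof -
    have PQ: "P $ j * P $ i = (if j = i then P $ i else 0)"
      "Q $ i * (Q $ j * P $ j) = (if j = i then Q $ i * P $ i else 0)" for j
      using P Q PP_simps[OF PP(1)] PP_simps[OF PP(2)] by (auto simp: PO_def simp flip: mult.assoc)
    show "W * P $ i = Q $ i * P $ i" "Q $ i * W = Q $ i * P $ i"
      by (simp_all add: PQ W_def transfer_def oblique_PO[OF P] sum_distrib_right sum_distrib_left
          mult.assoc if_distrib cong: if_cong)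
  qed
  then have WP: "W * P $ i = Q $ i * W" for i
    by simp
  have PW: "P $ i * star W = star W * Q $ i" for i
    using arg_cong[OF WP[of i], of star] by (simp add: star_mult PP_simps[OF PP(1)] PP_simps[OF PP(2)])
  define X where "X = ginv (binomial_sqrt h)"
  have R: "binomial_sqrt h \<in> GL"
    by (rule binomial_sqrt_GL[OF h(1,2)])
  have "binomial_sqrt h \<in> GL0"
    by (rule GL0_if_near_one[OF R norm_one_minus_binomial_sqrt[OF h(1)]])
  then have X: "X \<in> GL0"
    unfolding X_def by (rule GL0_ginv)
  \<comment> \<open>\<open>W\<close> carries \<open>P $ i\<close> to \<open>Q $ i\<close> and
    \<open>star W\<close> carries it back; so \<open>h\<close>, its root and \<open>X\<close>
    commute with \<open>P $ i\<close>.\<close>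
  have "h * P $ i = P $ i * h" for i
    by (simp add: h_def mult.assoc WP) (simp add: PW flip: mult.assoc)
  then have XP: "X * P $ i = P $ i * X" for i
    unfolding X_def by (intro ginv_commute R binomial_sqrt_commute h(1))
  have "star X = X"
    using GL_star(2)[OF R] by (simp add: X_def star_binomial_sqrt[OF h(1,3)])
  have "X * X = ginv h"
    using GL_mult(2)[OF R R] by (simp add: X_def binomial_sqrt_square[OF h(1)])
  also have "\<dots> = ginv W * ginv (star W)"
    by (simp add: h_def GL_mult WG GL_star)
  finally have "X * (X * star W) = ginv W"
    by (simp add: mult.assoc ginv_left[OF GL_star(1)[OF WG]] flip: mult.assoc[of X X])
  \<comment> \<open>\<open>X * star W\<close> is the adjoint of the unitary part
    \<open>W * X\<close> of \<open>W\<close>.\<close>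
  have "star (X * star W) * P $ i * (X * star W) = Q $ i" for i
  proof -
    have "star (X * star W) * P $ i * (X * star W) = W * (X * P $ i) * (X * star W)"
      by (simp add: star_mult star_star \<open>star X = X\<close> mult.assoc)
    also have "\<dots> = (W * P $ i) * (X * (X * star W))"
      by (simp only: XP mult.assoc)
    also have "\<dots> = Q $ i * (W * ginv W)"
      by (simp only: \<open>X * (X * star W) = ginv W\<close> WP mult.assoc)
    finally show ?thesis
      by (simp add: ginv_right[OF WG])
  qed
  then have "congruent_tuples Q P"
    unfolding congruent_tuples_def by (intro bexI[OF _ GL0_mult[OF X GL0_star[OF W]]]) simp
  then show "congruent_tuples P Q"
    by (rule congruent_tuples_sym)
qed

text \<open>An equivalence relation that holds near every point of a connected set holds throughout.
  Near \<open>S\<close>, pull back a neighbourhood of \<open>orthogonalise S\<close> and pass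
  through the orthogonal tuples.\<close>

lemma congruent_if_connected_component:
  fixes P Q :: "'a::cstar_algebra ^ 'n"
  assumes "connected_component PC P Q"
  shows "congruent_tuples P Q"
proof -
  let ?C = "connected_component_set PC P"
  have C: "?C \<subseteq> PC"
    by (rule connected_component_subset)
  show ?thesis
  proof (rule connected_equivalence_relation[of ?C])
    show "P \<in> ?C" "Q \<in> ?C"
      using assms connected_component_in[OF assms] by (auto intro: connected_component_refl)
    fix S assume "S \<in> ?C"
    then have S: "S \<in> PC"
      using C by blast
    obtain T where T: "open T" "orthogonalise S \<in> T"
      "\<And>Q. Q \<in> T \<inter> PO \<Longrightarrow> congruent_tuples (orthogonalise S) Q"
      using PO_locally_congruent[OF orthogonalise_PO[OF S]] by blast
    show "\<exists>T. openin (top_of_set ?C) T \<and> S \<in> T \<and> (\<forall>x\<in>T. congruent_tuples S x)"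
    proof (intro exI conjI ballI)
      show "openin (top_of_set ?C) (?C \<inter> orthogonalise -` T)"
        by (intro continuous_openin_preimage_gen continuous_on_subset[OF continuous_on_orthogonalise] C T)
      show "S \<in> ?C \<inter> orthogonalise -` T"
        using \<open>S \<in> ?C\<close> T by simp
      fix S' assume S': "S' \<in> ?C \<inter> orthogonalise -` T"
      then have "S' \<in> PC"
        using C by blast
      then show "congruent_tuples S S'"
        using T(3)[of "orthogonalise S'"] S' S
        by (blast intro: congruent_tuples_trans congruent_tuples_sym congruent_orthogonalise
            orthogonalise_PO)
    qed
  qed (auto intro: congruent_tuples_sym congruent_tuples_trans)
qed

text \<open>Congruence by \<open>D\<close> is the action of \<open>star D\<close>: the sums are
  congruent too, which makes the oblique idempotents similar via \<open>star D\<close>. Both tuples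
  thus lie in one continuous image of \<open>GL0\<close>.\<close>

lemma connected_component_if_congruent:
  fixes P Q :: "'a::cstar_algebra ^ 'n"
  assumes P: "P \<in> PC" and Q: "Q \<in> PC" and "congruent_tuples P Q"
  shows "connected_component PC P Q"
proof -
  obtain D where D: "D \<in> GL0" "\<And>i. P $ i = star D * Q $ i * D"
    using assms(3) by (auto simp: congruent_tuples_def)
  have DG: "D \<in> GL"
    using D GL0_subset_GL by blast
  let ?f = "\<lambda>D. move (star D) Q"
  have "?f D = P"
  proof (rule move_eqI[OF Q GL_star(1)[OF DG] P])
    fix i
    have "tuple_sum P = star D * tuple_sum Q * D"
      by (simp add: tuple_sum_def D(2) sum_distrib_left sum_distrib_right)
    then have "ginv (tuple_sum P) = ginv D * ginv (tuple_sum Q) * ginv (star D)"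
      using DG PC_tuple_sum_GL[OF Q] by (simp add: GL_mult GL_star mult.assoc)
    then show "star D * oblique Q i * ginv (star D) = oblique P i"
      by (simp add: oblique_def D(2) mult.assoc ginv_cancel[OF DG])
  qed
  moreover have "?f 1 = Q"
    by (simp add: star_one move_one[OF Q])
  ultimately have "P \<in> ?f ` GL0" "Q \<in> ?f ` GL0"
    using D(1) GL0_one by (metis imageI)+
  moreover have "connected (?f ` GL0)"
    using GL0_subset_GL Q
    by (intro connected_continuous_image connected_GL0 continuous_on_move continuous_on_star
        continuous_intros) (auto intro: GL_star)
  moreover have "?f ` GL0 \<subseteq> PC"
    using GL0_subset_GL by (auto intro!: move_PC Q GL_star)
  ultimately show ?thesis
    by (intro connected_componentI)
qed

theorem proposition4p5:
  assumes "CARD('n::finite) \<ge> 2"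
  shows "openin (top_of_set PP) (PI :: ('a::cstar_algebra ^ 'n) set) \<and>
    (openin (top_of_set PI) (PC :: ('a ^ 'n) set) \<and>
     closedin (top_of_set PI) (PC :: ('a ^ 'n) set)) \<and>
    (PO :: ('a ^ 'n) set) strong_deformation_retract_of PC \<and>
    (locally connected (PC :: ('a ^ 'n) set) \<and>
     (\<forall>C \<in> components (PC :: ('a ^ 'n) set). path_connected C)) \<and>
    (\<forall>P \<in> (PC :: ('a ^ 'n) set). \<forall>P' \<in> PC. connected_component PC P P' \<longleftrightarrow>
       (\<exists>D \<in> GL0. \<forall>i. P $ i = star D * P' $ i * D))"
proof -
  note lpc = locally_path_connected_PC[where 'a = 'a and 'n = 'n]
  \<comment> \<open>Local path-connectedness makes components coincide with path components.\<close>
  have "path_connected C" if C: "C \<in> components (PC :: ('a ^ 'n) set)" for C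
  proof -
    obtain P where "C = connected_component_set PC P"
      using C by (auto simp: components_iff)
    then show ?thesis
      by (simp flip: path_component_eq_connected_component_set[OF lpc])
  qed
  moreover have "connected_component PC P P' \<longleftrightarrow> (\<exists>D\<in>GL0. \<forall>i. P $ i = star D * P' $ i * D)"
    if "P \<in> PC" "P' \<in> PC" for P P' :: "'a ^ 'n"
    using congruent_if_connected_component connected_component_if_congruent[OF that]
    unfolding congruent_tuples_def by blast
  ultimately show ?thesis
    using openin_PI openin_PC closedin_PC PO_strong_deformation_retract_of_PC
      locally_path_connected_imp_locally_connected[OF lpc] by blast
qed

end
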